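(* Let $n\ge 1$, let $\mathbb{B}$ be the open unit ball of $\mathbb{C}^n$ with boundary $\mathbb{S}$, and let $\mu$ be a normal function on $[0,1)$. Let $f(z)=\sum_{k=0}^\infty P_{n_k}(z)$ be a holomorphic function on $\mathbb{B}$ with Hadamard gaps, where $P_{n_k}$ is a homogeneous polynomial of degree $n_k$, and put $M_{n_k}=\sup_{\xi\in\mathbb{S}}|P_{n_k}(\xi)|$. Then: (1) $f\in H^\infty_\mu$ if and only if $\sup_{k\ge1}\mu\left(1-\frac{1}{n_k}\right)M_{n_k}<\infty$; (2) $f\in H^\infty_{\mu,0}$ if and only if $\lim_{k\to\infty}\mu\left(1-\frac{1}{n_k}\right)M_{n_k}=0$.
   Context: A positive continuous function $\mu$ on $[0,1)$ is called normal if there exist numbers $0<\alpha<\beta$ and $\delta\in(0,1)$ such that $\frac{\mu(r)}{(1-r)^\alpha}$ is decreasing on $[\delta,1)$ with $\lim_{r\to1}\frac{\mu(r)}{(1-r)^\alpha}=0$, and $\frac{\mu(r)}{(1-r)^\beta}$ is increasing on $[\delta,1)$ with $\lim_{r\to1}\frac{\mu(r)}{(1-r)^\beta}=\infty$. $H(\mathbb{B})$ is the set of holomorphic functions on $\mathbb{B}$. The weighted-type space $H^\infty_\mu$ consists of all $f\in H(\mathbb{B})$ with $\|f\|=\sup_{z\in\mathbb{B}}\mu(|z|)|f(z)|<\infty$. The little weighted-type space $H^\infty_{\mu,0}$ consists of those $f\in H^\infty_\mu$ with $\lim_{|z|\to1^-}\mu(|z|)|f(z)|=0$. A function $f\in H(\mathbb{B})$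 has Hadamard gaps if $f(z)=\sum_{k=0}^\infty P_{n_k}(z)$, where each $P_{n_k}$ is a homogeneous polynomial of degree $n_k$, the $n_k$ are positive integers, and there exists a constant $c>1$ with $\frac{n_{k+1}}{n_k}\ge c$ for all $k\ge0$. *)

theory Defs
  imports "HOL-Analysis.Analysis"
begin

text \<open>
  \<open>\<complex>\<^sup>n\<close> is \<^typ>\<open>complex ^ 'n\<close>, whose library norm is the Euclidean one; \<open>n \<ge> 1\<close> holds because
  types are nonempty. A function on the unit ball is represented by a total function, of which
  only the values on \<open>ball 0 1\<close> matter.
\<close>

definition normal_weight :: "(real \<Rightarrow> real) \<Rightarrow> bool" where
  "normal_weight \<mu> \<longleftrightarrow>
     continuous_on {0..<1} \<mu> \<and> (\<forall>r\<in>{0..<1}. \<mu> r > 0) \<and>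
     (\<exists>\<alpha> \<beta> \<delta>. 0 < \<alpha> \<and> \<alpha> < \<beta> \<and> 0 < \<delta> \<and> \<delta> < 1 \<and>
        antimono_on {\<delta>..<1} (\<lambda>r. \<mu> r / (1 - r) powr \<alpha>) \<and>
        ((\<lambda>r. \<mu> r / (1 - r) powr \<alpha>) \<longlongrightarrow> 0) (at_left 1) \<and>
        mono_on {\<delta>..<1} (\<lambda>r. \<mu> r / (1 - r) powr \<beta>) \<and>
        filterlim (\<lambda>r. \<mu> r / (1 - r) powr \<beta>) at_top (at_left 1))"

text \<open>
  Holomorphy in several variables, as Frechet differentiability with a complex-linear derivative
  (\<open>has_derivative\<close> alone only gives a real-linear one).
\<close>
definition holomorphic_ball :: "(complex ^ 'n \<Rightarrow> complex) set" where
  "holomorphic_ball = {f. \<forall>z\<in>ball 0 1. \<exists>D. (f has_derivative D) (at z) \<and>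
                             (\<forall>c v. D (c *s v) = c * D v)}"

definition weighted_norm :: "(real \<Rightarrow> real) \<Rightarrow> (complex ^ 'n \<Rightarrow> complex) \<Rightarrow> ereal" where
  "weighted_norm \<mu> f = (SUP z\<in>ball 0 1. ereal (\<mu> (norm z) * cmod (f z)))"

definition weighted_space :: "(real \<Rightarrow> real) \<Rightarrow> (complex ^ 'n \<Rightarrow> complex) set" where
  "weighted_space \<mu> = {f \<in> holomorphic_ball. weighted_norm \<mu> f < \<infinity>}"

text \<open>The filter \<open>filtercomap norm (at_left 1)\<close> expresses \<open>|z| \<rightarrow> 1\<close> from below.\<close>
definition little_weighted_space :: "(real \<Rightarrow> real) \<Rightarrow> (complex ^ 'n \<Rightarrow> complex) set" where
  "little_weighted_space \<mu> = {f \<in> weighted_space \<mu>.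
     ((\<lambda>z. \<mu> (norm z) * cmod (f z)) \<longlongrightarrow> 0) (filtercomap norm (at_left 1))}"

text \<open>
  The coefficients are indexed by multi-indices \<open>a :: 'n \<Rightarrow> nat\<close>. As usual, the zero polynomial
  is homogeneous of every degree.
\<close>
definition homogeneous_polynomial :: "nat \<Rightarrow> (complex ^ 'n \<Rightarrow> complex) \<Rightarrow> bool" where
  "homogeneous_polynomial d p \<longleftrightarrow>
     (\<exists>c :: ('n \<Rightarrow> nat) \<Rightarrow> complex. \<forall>z.
        p z = (\<Sum>a | (\<Sum>i\<in>UNIV. a i) = d. c a * (\<Prod>i\<in>UNIV. (z $ i) ^ a i)))"

text \<open>
  \<open>f\<close> is a holomorphic function on the ball with Hadamard gaps, with expansion \<open>f = (\<Sum>k. P k)\<close>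
  where \<open>P k\<close> has degree \<open>N k\<close>.
\<close>
definition hadamard_gap_expansion ::
    "(complex ^ 'n \<Rightarrow> complex) \<Rightarrow> (nat \<Rightarrow> nat) \<Rightarrow> (nat \<Rightarrow> complex ^ 'n \<Rightarrow> complex) \<Rightarrow> bool" where
  "hadamard_gap_expansion f N P \<longleftrightarrow>
     f \<in> holomorphic_ball \<and>
     (\<forall>k. N k > 0 \<and> homogeneous_polynomial (N k) (P k)) \<and>
     (\<exists>c>1. \<forall>k. real (N (Suc k)) / real (N k) \<ge> c) \<and>
     (\<forall>z\<in>ball 0 1. (\<lambda>k. P k z) sums f z)"

definition sphere_sup :: "(complex ^ 'n \<Rightarrow> complex) \<Rightarrow> real" where
  "sphere_sup p = (SUP \<xi>\<in>sphere 0 1. cmod (p \<xi>))"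

end

theory Submission
  imports Defs "HOL-Complex_Analysis.Complex_Analysis"
begin

text \<open>
  For \<open>\<xi>\<close> on the sphere, \<open>w \<mapsto> f (w \<xi>)\<close> is a power series on the disc with coefficients
  \<open>P k \<xi>\<close>, so Cauchy's inequality on \<open>\<bar>w\<bar> = 1 - 1 / N k\<close> bounds the coefficient, the loss
  \<open>(1 - 1 / N k) ^ N k\<close> being bounded below.

  Conversely \<open>\<bar>f z\<bar> \<le> (\<Sum>k. M k * r ^ N k)\<close> with \<open>r = \<bar>z\<bar>\<close>. Put \<open>y k = N k * (1 - r)\<close>.
  Normality gives \<open>\<mu> r / \<mu> (1 - 1 / N k) \<le> y k powr \<alpha> + y k powr \<beta>\<close>, and \<open>r ^ N k \<le> exp (- y k)\<close>.
  As \<open>y\<close> is lacunary, the sums of \<open>y k powr g * exp (- y k)\<close> are bounded independently of \<open>r\<close>.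
  For the little space only a tail is estimated this way: the finitely many remaining terms
  vanish in the limit because \<open>\<mu> r\<close> does.
\<close>

section \<open>Cauchy's inequality for power series coefficients\<close>

lemma vector_norm_mult: "norm (c *s x) = norm c * norm x"
  for c :: complex and x :: "complex ^ 'n"
  by (simp add: norm_vec_def norm_mult L2_set_right_distrib)

text \<open>The coefficient \<open>a n\<close> is the n-th Taylor coefficient of \<open>g\<close> at
  0, so Cauchy's inequality for derivatives on the circle of radius \<open>r\<close> applies; the
  factorials cancel.\<close>

lemma cauchy_coefficient_estimate:
  fixes a :: "nat \<Rightarrow> complex"
  assumes sums: "\<And>w. w \<in> ball 0 R \<Longrightarrow> (\<lambda>n. a n * w ^ n) sums g w"
    and r: "0 < r" "r < R"
    and bound: "\<And>w. cmod w = r \<Longrightarrow> cmod (g w) \<le> B"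
  shows "cmod (a n) * r ^ n \<le> B"
proof -
  have hol: "g holomorphic_on ball 0 R"
    using power_series_holomorphic[of 0 R a g] sums by simp
  have "g has_fps_expansion Abs_fps a"
    unfolding has_fps_expansion_def
  proof
    \<comment> \<open>Convergence at the single point \<open>r\<close> already forces a convergence
      radius of at least \<open>r\<close>, hence a positive one.\<close>
    have "summable (\<lambda>n. a n * of_real r ^ n)"
      using sums[of "of_real r"] r by (auto simp: sums_iff)
    then have "conv_radius a \<ge> norm (of_real r :: complex)"
      by (rule conv_radius_geI)
    then show "0 < fps_conv_radius (Abs_fps a)"
      using r by (simp add: fps_conv_radius_def) (meson ereal_less(2) less_le_trans)
    show "\<forall>\<^sub>F z in nhds 0. eval_fps (Abs_fps a) z = g z"
      by (rule eventually_nhds_in_open[of "ball 0 R" 0, THEN eventually_mono])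
         (use r sums in \<open>auto simp: eval_fps_def sums_iff\<close>)
  qed
  then have coeff: "(deriv ^^ n) g 0 = a n * fact n"
    using fps_nth_fps_expansion[of g "Abs_fps a" n] by simp
  have "cmod ((deriv ^^ n) g 0) \<le> fact n * B / r ^ n"
  proof (rule Cauchy_inequality)
    show "g holomorphic_on ball 0 r"
      using hol r by (auto intro: holomorphic_on_subset)
    show "continuous_on (cball 0 r) g"
      using hol r by (intro holomorphic_on_imp_continuous_on) (auto intro: holomorphic_on_subset)
  qed (use r bound in auto)
  then show ?thesis
    using r by (simp add: coeff norm_mult field_simps)
qed

section \<open>Exponential inequalities and lacunary sums\<close>

lemma power_le_exp:
  assumes "r \<ge> 0"
  shows "r ^ n \<le> exp (- (real n * (1 - r)))"
proof -
  have "r ^ n \<le> exp (r - 1) ^ n"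
    using exp_ge_add_one_self[of "r - 1"] assms by (intro power_mono) auto
  also have "\<dots> = exp (- (real n * (1 - r)))"
    by (simp add: exp_of_nat_mult[symmetric] algebra_simps)
  finally show ?thesis .
qed

text \<open>The inverse of \<open>1 - 1 / n\<close> is \<open>1 + 1 / (n - 1)\<close>, which is at
  most \<open>exp (1 / (n - 1))\<close>; moreover \<open>n / (n - 1)\<close> is at most 2 once
  \<open>n \<ge> 2\<close>.\<close>

lemma exp_minus_two_le_power:
  assumes "n \<ge> 2"
  shows "exp (- 2) \<le> (1 - 1 / real n) ^ n"
proof -
  have n: "real n \<ge> 2" using assms by simp
  have "exp (- 2) \<le> exp (- 1 / (real n - 1)) ^ n"
    using n by (simp add: exp_of_nat_mult[symmetric] field_simps)
  also have "\<dots> \<le> (1 - 1 / real n) ^ n"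
  proof (rule power_mono)
    have "1 + 1 / (real n - 1) \<le> exp (1 / (real n - 1))"
      by (rule exp_ge_add_one_self)
    then have "inverse (exp (1 / (real n - 1))) \<le> inverse (1 + 1 / (real n - 1))"
      using n by (intro le_imp_inverse_le) (auto intro: add_pos_nonneg)
    also have "inverse (1 + 1 / (real n - 1)) = 1 - 1 / real n"
      using n by (simp add: field_simps)
    finally show "exp (- 1 / (real n - 1)) \<le> 1 - 1 / real n"
      by (simp add: exp_minus[symmetric])
  qed simp
  finally show ?thesis .
qed

text \<open>A single term of the exponential series is at most the whole series.\<close>

lemma power_le_fact_exp:
  fixes y :: real
  assumes "y \<ge> 0"
  shows "y ^ m \<le> fact m * exp y"
proof -
  have "(\<Sum>n\<in>{m}. inverse (fact n) * y ^ n) \<le> (\<Sum>n. inverse (fact n) * y ^ n)"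
    using assms by (intro sum_le_suminf summable_exp) auto
  then have "inverse (fact m) * y ^ m \<le> exp y"
    by (simp add: exp_def scaleR_conv_of_real)
  then show ?thesis
    by (simp add: field_simps)
qed

text \<open>
  With \<open>\<phi> u = u / (1 + u)\<close> the summand is at most a constant times
  \<open>\<phi> (y (Suc k) powr g) - \<phi> (y k powr g)\<close>, so the sum telescopes.
\<close>
lemma lacunary_sum_bound:
  fixes c g :: real
  assumes c: "c > 1" and g: "g > 0"
  obtains K where "\<And>(y :: nat \<Rightarrow> real) n.
      (\<And>k. y k > 0) \<Longrightarrow> (\<And>k. y (Suc k) \<ge> c * y k) \<Longrightarrow>
      (\<Sum>k<n. y k powr g * exp (- y k)) \<le> K"
proof -
  \<comment> \<open>An integer exponent of at least \<open>2 * g\<close> makes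
    \<open>power_le_fact_exp\<close> available for real powers of \<open>y > 1\<close>.\<close>
  define m where "m = nat \<lceil>2 * g\<rceil>"
  define q where "q = c powr g"
  have q: "q > 1" using c g by (simp add: q_def)
  \<comment> \<open>Product of the constant \<open>4 * fact m\<close> from \<open>bounded\<close>
    and the constant \<open>q / (q - 1)\<close> from \<open>\<phi>_diff\<close>.\<close>
  define A where "A = 4 * fact m * q / (q - 1)"
  have A: "A > 0" using q by (simp add: A_def)
  \<comment> \<open>This replaces \<open>exp (- y)\<close> by a multiple of
    \<open>1 / (1 + u)^2\<close> with \<open>u = y powr g\<close>, and \<open>1 / (1 + u)^2\<close>
    is the derivative of the function \<open>\<phi>\<close> below.\<close>
  have bounded: "(1 + y powr g)\<^sup>2 * exp (- y) \<le> 4 * fact m" if "y > 0" for y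
  proof -
    have "(1 + y powr g)\<^sup>2 \<le> 4 * (fact m * exp y)"
    proof (cases "y \<le> 1")
      case True
      then have "y powr g \<le> 1" using that g by (simp add: powr_le1)
      then have "(1 + y powr g)\<^sup>2 \<le> 2\<^sup>2" by (intro power_mono) auto
      moreover have "(1::real) * 1 \<le> fact m * exp y"
        using that by (intro mult_mono) (auto simp: fact_ge_1)
      ultimately show ?thesis by simp
    next
      case False
      then have "1 \<le> y powr g" using g by (simp add: ge_one_powr_ge_zero)
      then have "(1 + y powr g)\<^sup>2 \<le> (2 * y powr g)\<^sup>2" by (intro power_mono) auto
      also have "\<dots> = 4 * y powr (2 * g)"
        by (simp add: power2_eq_square powr_add[symmetric])
      also have "y powr (2 * g) \<le> y powr real m"
        using False of_nat_ceiling[of "2 * g"] by (intro powr_mono) (auto simp: m_def)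
      also have "\<dots> = y ^ m" using that by (simp add: powr_realpow)
      also have "\<dots> \<le> fact m * exp y" using that by (intro power_le_fact_exp) auto
      finally show ?thesis by simp
    qed
    then show ?thesis by (simp add: exp_minus field_simps)
  qed
  define \<phi> :: "real \<Rightarrow> real" where "\<phi> u = u / (1 + u)" for u
  have \<phi>_mono: "\<phi> u \<le> \<phi> v" if "0 \<le> u" "u \<le> v" for u v
    using that by (simp add: \<phi>_def field_simps)
  have \<phi>_diff: "u / (1 + u)\<^sup>2 \<le> q / (q - 1) * (\<phi> (q * u) - \<phi> u)" if "u > 0" for u
  proof -
    have pos: "1 + q * u > 0" using that q by (simp add: add_pos_pos)
    have "\<phi> (q * u) - \<phi> u = (q - 1) * u / ((1 + q * u) * (1 + u))"
      using that pos by (simp add: \<phi>_def divide_simps) (simp add: algebra_simps)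
    then have eq: "q / (q - 1) * (\<phi> (q * u) - \<phi> u) = q * u / ((1 + q * u) * (1 + u))"
      using q by simp
    \<comment> \<open>Since \<open>q > 1\<close>, \<open>1 + q * u\<close> is at most
      \<open>q * (1 + u)\<close>, so passing to the denominator \<open>(1 + u)^2\<close> costs only
      a factor \<open>q\<close>.\<close>
    have "(1 + q * u) * (1 + u) \<le> q * ((1 + u) * (1 + u))"
    proof -
      have "(1 + q * u) * (1 + u) \<le> (q * (1 + u)) * (1 + u)"
        using that q by (intro mult_right_mono) (auto simp: distrib_left)
      then show ?thesis by (simp add: mult.assoc)
    qed
    then have "q * u / (q * ((1 + u) * (1 + u))) \<le> q * u / ((1 + q * u) * (1 + u))"
      using that q pos by (intro divide_left_mono) auto
    then show ?thesis using q unfolding eq by (simp add: power2_eq_square)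
  qed
  show thesis
  proof (rule that)
    fix y :: "nat \<Rightarrow> real" and n
    assume pos: "\<And>k. y k > 0" and gap: "\<And>k. y (Suc k) \<ge> c * y k"
    let ?u = "\<lambda>k. y k powr g"
    have step: "?u k * exp (- y k) \<le> A * (\<phi> (?u (Suc k)) - \<phi> (?u k))" for k
    proof -
      have u: "?u k > 0" using pos[of k] by simp
      have "?u k * exp (- y k) = ?u k / (1 + ?u k)\<^sup>2 * ((1 + ?u k)\<^sup>2 * exp (- y k))"
        using u by (simp add: add_nonneg_eq_0_iff)
      also have "\<dots> \<le> ?u k / (1 + ?u k)\<^sup>2 * (4 * fact m)"
        using bounded[OF pos] u by (intro mult_left_mono) auto
      also have "\<dots> \<le> q / (q - 1) * (\<phi> (q * ?u k) - \<phi> (?u k)) * (4 * fact m)"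
        using \<phi>_diff[OF u] by (intro mult_right_mono) auto
      also have "\<dots> = A * (\<phi> (q * ?u k) - \<phi> (?u k))"
        by (simp add: A_def)
      \<comment> \<open>Lacunarity enters here: the ratio \<open>c\<close> of the \<open>y k\<close>
        becomes the ratio \<open>q\<close> of their powers, and \<open>\<phi>\<close> is
        monotone.\<close>
      also have "\<dots> \<le> A * (\<phi> (?u (Suc k)) - \<phi> (?u k))"
      proof -
        have "q * ?u k = (c * y k) powr g"
          using c pos[of k] by (simp add: q_def powr_mult)
        also have "\<dots> \<le> ?u (Suc k)"
          using gap[of k] c g pos[of k] by (intro powr_mono2) auto
        finally show ?thesis
          using A q u by (intro mult_left_mono diff_right_mono \<phi>_mono) auto
      qed
      finally show ?thesis .
    qed
    have "(\<Sum>k<n. ?u k * exp (- y k)) \<le> (\<Sum>k<n. A * (\<phi> (?u (Suc k)) - \<phi> (?u k)))"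
      by (intro sum_mono step)
    also have "\<dots> = A * (\<phi> (?u n) - \<phi> (?u 0))"
      using sum_lessThan_telescope[of "\<lambda>k. \<phi> (?u k)" n] by (simp add: sum_distrib_left[symmetric])
    \<comment> \<open>\<open>\<phi>\<close> takes nonnegative arguments to values in [0,1), so the
      telescoped bound depends neither on \<open>y\<close> nor on \<open>n\<close>.\<close>
    also have "\<dots> \<le> A * 1"
    proof -
      have "\<phi> (?u n) \<le> 1" "\<phi> (?u 0) \<ge> 0"
        using pos[of n] pos[of 0] by (auto simp: \<phi>_def add_nonneg_pos divide_le_eq)
      then show ?thesis using A by (intro mult_left_mono) auto
    qed
    finally show "(\<Sum>k<n. ?u k * exp (- y k)) \<le> A" by simp
  qed
qed

section \<open>Normal weights\<close>

lemma normal_weight_pos: "normal_weight \<mu> \<Longrightarrow> 0 \<le> r \<Longrightarrow> r < 1 \<Longrightarrow> \<mu> r > 0"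
  by (auto simp: normal_weight_def)

text \<open>The decreasing quotient gives the power \<alpha> when \<open>s \<le> r\<close>, the
  increasing one the power \<beta> otherwise. Adding both powers gives a single bound that needs no
  knowledge of the order of \<open>r\<close> and \<open>s\<close>.\<close>

lemma normal_weight_ratio:
  assumes "normal_weight \<mu>"
  obtains \<alpha> \<beta> \<delta> where "0 < \<alpha>" "0 < \<beta>" "0 < \<delta>" "\<delta> < 1"
    "\<And>r s. \<delta> \<le> r \<Longrightarrow> r < 1 \<Longrightarrow> \<delta> \<le> s \<Longrightarrow> s < 1 \<Longrightarrow>
      \<mu> r / \<mu> s \<le> ((1 - r) / (1 - s)) powr \<alpha> + ((1 - r) / (1 - s)) powr \<beta>"
proof -
  obtain \<alpha> \<beta> \<delta> where *: "0 < \<alpha>" "\<alpha> < \<beta>" "0 < \<delta>" "\<delta> < 1"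
    and dec: "antimono_on {\<delta>..<1} (\<lambda>r. \<mu> r / (1 - r) powr \<alpha>)"
    and inc: "mono_on {\<delta>..<1} (\<lambda>r. \<mu> r / (1 - r) powr \<beta>)"
    using assms unfolding normal_weight_def by blast
  have "\<mu> r / \<mu> s \<le> ((1 - r) / (1 - s)) powr \<alpha> + ((1 - r) / (1 - s)) powr \<beta>"
    if "\<delta> \<le> r" "r < 1" "\<delta> \<le> s" "s < 1" for r s
  proof -
    have pos: "\<mu> r > 0" "\<mu> s > 0"
      using that * assms by (auto intro: normal_weight_pos)
    have "\<mu> r / \<mu> s \<le> ((1 - r) / (1 - s)) powr \<alpha> \<or> \<mu> r / \<mu> s \<le> ((1 - r) / (1 - s)) powr \<beta>"
    proof (cases "s \<le> r")
      case True
      then have "\<mu> r / (1 - r) powr \<alpha> \<le> \<mu> s / (1 - s) powr \<alpha>"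
        using monotone_onD[OF dec] that by auto
      then show ?thesis
        using that pos by (simp add: powr_divide field_simps)
    next
      case False
      then have "\<mu> r / (1 - r) powr \<beta> \<le> \<mu> s / (1 - s) powr \<beta>"
        using monotone_onD[OF inc] that by auto
      then show ?thesis
        using that pos by (simp add: powr_divide field_simps)
    qed
    moreover have "0 \<le> ((1 - r) / (1 - s)) powr \<alpha>" "0 \<le> ((1 - r) / (1 - s)) powr \<beta>"
      by simp_all
    ultimately show ?thesis by linarith
  qed
  with * show thesis by (intro that[of \<alpha> \<beta> \<delta>]) auto
qed

text \<open>Near 1 the factor \<open>(1 - r) powr \<alpha>\<close> is at most 1, so
  \<open>\<mu> r\<close> is dominated by a quotient that tends to 0.\<close>

lemma normal_weight_tendsto_0:
  assumes "normal_weight \<mu>"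
  shows "(\<mu> \<longlongrightarrow> 0) (at_left 1)"
proof -
  obtain \<alpha> where \<alpha>: "0 < \<alpha>" and lim: "((\<lambda>r. \<mu> r / (1 - r) powr \<alpha>) \<longlongrightarrow> 0) (at_left 1)"
    using assms unfolding normal_weight_def by blast
  have "\<forall>\<^sub>F r in at_left (1::real). r \<in> {0<..<1}"
    by (rule eventually_at_left_real) simp
  then have "\<forall>\<^sub>F r in at_left 1. norm (\<mu> r) \<le> \<mu> r / (1 - r) powr \<alpha>"
  proof eventually_elim
    case (elim r)
    then have "(1 - r) powr \<alpha> \<le> 1" "\<mu> r > 0" "(1 - r) powr \<alpha> > 0"
      using \<alpha> assms by (auto intro: normal_weight_pos powr_le1)
    then show ?case by (simp add: le_divide_eq mult_left_le)
  qed
  then show ?thesis using lim by (rule Lim_null_comparison)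
qed

text \<open>The limit 0 controls \<mu> near 1, compactness controls it on the remaining closed
  interval.\<close>

lemma normal_weight_bounded:
  assumes "normal_weight \<mu>"
  obtains B where "\<And>r. 0 \<le> r \<Longrightarrow> r < 1 \<Longrightarrow> \<mu> r \<le> B"
proof -
  have "\<forall>\<^sub>F r in at_left 1. \<mu> r < 1"
    using normal_weight_tendsto_0[OF assms] by (rule order_tendstoD) simp
  then obtain b where b: "b < 1" "\<And>r. b < r \<Longrightarrow> r < 1 \<Longrightarrow> \<mu> r < 1"
    by (auto simp: eventually_at_left_field)
  have "continuous_on {0..b} \<mu>"
    using assms b(1) by (auto simp: normal_weight_def intro: continuous_on_subset)
  then have "bounded (\<mu> ` {0..b})"
    by (intro compact_imp_bounded compact_continuous_image) auto
  then obtain B where B: "\<And>r. r \<in> {0..b} \<Longrightarrow> norm (\<mu> r) \<le> B"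
    unfolding bounded_iff by blast
  show thesis
  proof (rule that)
    fix r :: real assume "0 \<le> r" "r < 1"
    then show "\<mu> r \<le> max B 1" using B[of r] b(2)[of r] by (cases "r \<le> b") auto
  qed
qed

section \<open>Homogeneous polynomials and their suprema on the sphere\<close>

lemma homogeneous_polynomial_scale:
  assumes "homogeneous_polynomial d p"
  shows "p (c *s z) = c ^ d * p z"
proof -
  obtain C where p: "\<And>z. p z = (\<Sum>a | sum a UNIV = d. C a * (\<Prod>i\<in>UNIV. (z $ i) ^ a i))"
    using assms by (auto simp: homogeneous_polynomial_def)
  show ?thesis
    unfolding p sum_distrib_left
    by (intro sum.cong) (auto simp: power_mult_distrib prod.distrib power_sum[symmetric])
qed

lemma homogeneous_polynomial_continuous:
  assumes "homogeneous_polynomial d p"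
  shows "continuous_on S p"
proof -
  obtain C where p: "p = (\<lambda>z. \<Sum>a | sum a UNIV = d. C a * (\<Prod>i\<in>UNIV. (z $ i) ^ a i))"
    using assms by (auto simp: homogeneous_polynomial_def fun_eq_iff)
  show ?thesis unfolding p by (intro continuous_intros)
qed

text \<open>Compactness of the sphere bounds the set of values, without which the real-valued
  \<open>SUP\<close> would carry no information.\<close>

lemma norm_le_sphere_sup:
  assumes "homogeneous_polynomial d p" "\<xi> \<in> sphere 0 1"
  shows "cmod (p \<xi>) \<le> sphere_sup p"
proof -
  have "compact ((\<lambda>\<xi>. cmod (p \<xi>)) ` sphere 0 1)"
    using assms(1)
    by (intro compact_continuous_image continuous_on_norm homogeneous_polynomial_continuous) auto
  then have "bdd_above ((\<lambda>\<xi>. cmod (p \<xi>)) ` sphere 0 1)"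
    by (intro bounded_imp_bdd_above compact_imp_bounded)
  then show ?thesis
    unfolding sphere_sup_def using assms(2) by (intro cSUP_upper)
qed

lemma sphere_sup_le:
  fixes p :: "complex ^ 'n \<Rightarrow> complex"
  assumes "\<And>\<xi>. \<xi> \<in> sphere 0 1 \<Longrightarrow> cmod (p \<xi>) \<le> B"
  shows "sphere_sup p \<le> B"
proof -
  \<comment> \<open>A least-upper-bound argument for a real \<open>SUP\<close> needs a nonempty
    index set.\<close>
  obtain \<xi> :: "complex ^ 'n" where "\<xi> \<in> sphere 0 1"
    using vector_choose_size[of 1] by auto
  then show ?thesis
    unfolding sphere_sup_def using assms by (intro cSUP_least) blast+
qed

lemma sphere_sup_nonneg:
  fixes p :: "complex ^ 'n \<Rightarrow> complex"
  assumes "homogeneous_polynomial d p"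
  shows "sphere_sup p \<ge> 0"
proof -
  obtain \<xi> :: "complex ^ 'n" where "\<xi> \<in> sphere 0 1"
    using vector_choose_size[of 1] by auto
  then show ?thesis
    using norm_le_sphere_sup[OF assms] norm_ge_zero order_trans by blast
qed

text \<open>Rescaling a nonzero \<open>z\<close> to the sphere pulls out \<open>norm z ^ d\<close>.
  At the origin, scaling by 0 gives \<open>p 0 = 0\<close> because \<open>d > 0\<close>.\<close>

lemma homogeneous_polynomial_norm_le:
  fixes z :: "complex ^ 'n"
  assumes "homogeneous_polynomial d p" "d > 0"
  shows "cmod (p z) \<le> sphere_sup p * norm z ^ d"
proof (cases "z = 0")
  case True
  then show ?thesis
    using homogeneous_polynomial_scale[OF assms(1), of 0 0] assms(2)
    by (auto simp: vector_smult_lzero power_0_left)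
next
  case False
  define \<xi> where "\<xi> = of_real (inverse (norm z)) *s z"
  have "z = of_real (norm z) *s \<xi>"
    using False by (simp add: \<xi>_def vector_smult_assoc)
  then have "p z = of_real (norm z) ^ d * p \<xi>"
    using homogeneous_polynomial_scale[OF assms(1)] by metis
  moreover have "\<xi> \<in> sphere 0 1"
    using False by (simp add: \<xi>_def vector_norm_mult norm_inverse)
  ultimately show ?thesis
    using norm_le_sphere_sup[OF assms(1)] by (auto simp: norm_mult norm_power mult.commute intro: mult_right_mono)
qed

section \<open>Coefficient and growth estimates for gap series\<close>

lemma hadamard_gap_strict_mono:
  assumes "hadamard_gap_expansion f N P"
  shows "strict_mono N"
  unfolding strict_mono_Suc_iff
proof
  fix k
  obtain c where "c > 1" "real (N (Suc k)) / real (N k) \<ge> c" "N k > 0"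
    using assms by (auto simp: hadamard_gap_expansion_def)
  then have "real (N (Suc k)) \<ge> c * real (N k)" "c * real (N k) > real (N k)"
    by (auto simp: le_divide_eq)
  then have "real (N k) < real (N (Suc k))" by linarith
  then show "N k < N (Suc k)" by simp
qed

text \<open>Used in two ways: \<open>N k \<ge> 2\<close> for \<open>k \<ge> 1\<close>, which keeps
  the radius \<open>1 - 1 / N k\<close> positive, and \<open>N k\<close> passes any threshold that
  \<open>k\<close> has reached.\<close>

lemma hadamard_gap_degree_gt:
  assumes "hadamard_gap_expansion f N P"
  shows "N k > k"
proof -
  have "N 0 > 0" using assms by (simp add: hadamard_gap_expansion_def)
  moreover have "N k \<ge> N 0 + k"
    using hadamard_gap_strict_mono[OF assms]
    by (induction k) (auto simp: strict_mono_Suc_iff Suc_le_eq intro: le_less_trans)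
  ultimately show ?thesis by linarith
qed

text \<open>\<open>w *s \<xi>\<close> has norm \<open>r\<close> whenever \<open>cmod w = r\<close>,
  so Cauchy's inequality holds on every complex line with the same \<open>B\<close>, and the
  supremum over \<xi> can be taken afterwards.\<close>

lemma hadamard_gap_coefficient_bound:
  fixes f :: "complex ^ 'n \<Rightarrow> complex"
  assumes f: "hadamard_gap_expansion f N P"
    and r: "0 < r" "r < 1"
    and bound: "\<And>z. norm z = r \<Longrightarrow> cmod (f z) \<le> B"
  shows "sphere_sup (P k) * r ^ N k \<le> B"
proof -
  have hom: "homogeneous_polynomial (N k) (P k)" for k
    using f by (simp add: hadamard_gap_expansion_def)
  have mono: "strict_mono N" using f by (rule hadamard_gap_strict_mono)
  have "cmod (P k \<xi>) * r ^ N k \<le> B" if \<xi>: "\<xi> \<in> sphere 0 1" for \<xi>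
  proof -
    \<comment> \<open>The missing degrees get coefficient 0, which turns the gap series into an
      ordinary power series; \<open>inv N\<close> recovers the index because \<open>N\<close> is
      injective.\<close>
    define a where "a n = (if n \<in> range N then P (inv N n) \<xi> else 0)" for n
    have a_N: "a (N k) = P k \<xi>" for k
      using mono by (simp add: a_def strict_mono_imp_inj_on)
    have "cmod (a (N k)) * r ^ N k \<le> B"
    proof (rule cauchy_coefficient_estimate[where R = 1 and g = "\<lambda>w. f (w *s \<xi>)"])
      fix w :: complex assume w: "w \<in> ball 0 1"
      then have "w *s \<xi> \<in> ball 0 1" using \<xi> by (simp add: vector_norm_mult)
      then have "(\<lambda>k. P k (w *s \<xi>)) sums f (w *s \<xi>)"
        using f by (simp add: hadamard_gap_expansion_def)
      also have "(\<lambda>k. P k (w *s \<xi>)) = (\<lambda>k. a (N k) * w ^ N k)"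
        by (simp add: a_N homogeneous_polynomial_scale[OF hom] mult.commute)
      finally show "(\<lambda>n. a n * w ^ n) sums f (w *s \<xi>)"
        using mono by (subst (asm) sums_mono_reindex) (auto simp: a_def)
    next
      fix w :: complex assume "cmod w = r"
      then show "cmod (f (w *s \<xi>)) \<le> B"
        using \<xi> by (intro bound) (simp add: vector_norm_mult)
    qed (use r in auto)
    then show ?thesis by (simp add: a_N)
  qed
  then have "sphere_sup (P k) \<le> B / r ^ N k"
    using r by (intro sphere_sup_le) (simp add: le_divide_eq)
  then show ?thesis using r by (simp add: le_divide_eq)
qed

text \<open>The bound is assumed on one sphere only, so that it can be a global bound for the big
  space and a small one near the boundary for the little space.\<close>

lemma hadamard_gap_weighted_coefficient_bound:
  fixes f :: "complex ^ 'n \<Rightarrow> complex"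
  assumes \<mu>: "normal_weight \<mu>" and f: "hadamard_gap_expansion f N P"
    and k: "k \<ge> 1"
    and bound: "\<And>z. norm z = 1 - 1 / real (N k) \<Longrightarrow> \<mu> (norm z) * cmod (f z) \<le> B"
  shows "\<mu> (1 - 1 / real (N k)) * sphere_sup (P k) \<le> B * exp 2"
proof -
  define r where "r = 1 - 1 / real (N k)"
  have N: "N k \<ge> 2" using hadamard_gap_degree_gt[OF f, of k] k by simp
  then have r: "0 < r" "r < 1" by (auto simp: r_def)
  then have \<mu>_pos: "\<mu> r > 0" using \<mu> by (simp add: normal_weight_pos)
  have M: "sphere_sup (P k) \<ge> 0"
    using f by (auto simp: hadamard_gap_expansion_def intro: sphere_sup_nonneg)
  have "sphere_sup (P k) * exp (- 2) \<le> sphere_sup (P k) * r ^ N k"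
    unfolding r_def by (intro mult_left_mono exp_minus_two_le_power N M)
  also have "\<dots> \<le> B / \<mu> r"
  proof (rule hadamard_gap_coefficient_bound[OF f r])
    fix z :: "complex ^ 'n" assume "norm z = r"
    then show "cmod (f z) \<le> B / \<mu> r"
      using bound[of z] \<mu>_pos by (simp add: r_def le_divide_eq mult.commute)
  qed
  finally show ?thesis
    using \<mu>_pos by (simp add: r_def[symmetric] exp_minus field_simps)
qed

text \<open>The constants \<open>K\<close>, \<open>\<delta>\<close> and \<open>k0\<close> are chosen
  before \<open>e\<close> and \<open>k1\<close>. The big space takes a fixed \<open>e\<close>; the
  little space lets \<open>e\<close> shrink and \<open>k1\<close> grow with it.\<close>

lemma hadamard_gap_weighted_growth:
  fixes f :: "complex ^ 'n \<Rightarrow> complex"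
  assumes \<mu>: "normal_weight \<mu>" and f: "hadamard_gap_expansion f N P"
  obtains K :: real and \<delta> :: real and k0 :: nat where "K > 0" "0 < \<delta>" "\<delta> < 1"
    "\<And>e k1 z. e \<ge> 0 \<Longrightarrow> k1 \<ge> k0 \<Longrightarrow>
      (\<And>k. k \<ge> k1 \<Longrightarrow> \<mu> (1 - 1 / real (N k)) * sphere_sup (P k) \<le> e) \<Longrightarrow>
      \<delta> \<le> norm z \<Longrightarrow> norm z < 1 \<Longrightarrow>
      \<mu> (norm z) * cmod (f z) \<le> \<mu> (norm z) * (\<Sum>k<k1. sphere_sup (P k)) + e * K"
proof -
  obtain \<alpha> \<beta> \<delta> where pars: "0 < \<alpha>" "0 < \<beta>" "0 < \<delta>" "\<delta> < 1"
    and ratio: "\<And>r s. \<delta> \<le> r \<Longrightarrow> r < 1 \<Longrightarrow> \<delta> \<le> s \<Longrightarrow> s < 1 \<Longrightarrow>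
      \<mu> r / \<mu> s \<le> ((1 - r) / (1 - s)) powr \<alpha> + ((1 - r) / (1 - s)) powr \<beta>"
    using normal_weight_ratio[OF \<mu>] by metis
  obtain c where c: "c > 1" and gap: "\<And>k. real (N (Suc k)) / real (N k) \<ge> c"
    using f by (auto simp: hadamard_gap_expansion_def)
  obtain K\<alpha> where K\<alpha>: "\<And>(y :: nat \<Rightarrow> real) n. (\<And>k. y k > 0) \<Longrightarrow> (\<And>k. y (Suc k) \<ge> c * y k) \<Longrightarrow>
      (\<Sum>k<n. y k powr \<alpha> * exp (- y k)) \<le> K\<alpha>"
    using lacunary_sum_bound[OF c \<open>0 < \<alpha>\<close>] by metis
  obtain K\<beta> where K\<beta>: "\<And>(y :: nat \<Rightarrow> real) n. (\<And>k. y k > 0) \<Longrightarrow> (\<And>k. y (Suc k) \<ge> c * y k) \<Longrightarrow>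
      (\<Sum>k<n. y k powr \<beta> * exp (- y k)) \<le> K\<beta>"
    using lacunary_sum_bound[OF c \<open>0 < \<beta>\<close>] by metis
  \<comment> \<open>The maximum with 1 makes \<open>K\<close> positive, as a later division by it
    requires.\<close>
  define K where "K = max 1 (K\<alpha> + K\<beta>)"
  \<comment> \<open>For \<open>k \<ge> k0\<close> this puts the radius \<open>1 - 1 / N k\<close>
    above \<open>\<delta>\<close>, where the ratio estimate is valid.\<close>
  obtain k0 :: nat where k0: "k0 > 1 / (1 - \<delta>)"
    using reals_Archimedean2 by blast
  have N_pos: "N k > 0" and hom: "homogeneous_polynomial (N k) (P k)" for k
    using f by (auto simp: hadamard_gap_expansion_def)
  have M: "sphere_sup (P k) \<ge> 0" for k
    using hom by (rule sphere_sup_nonneg)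
  have main: "\<mu> (norm z) * cmod (f z) \<le> \<mu> (norm z) * (\<Sum>k<k1. sphere_sup (P k)) + e * K"
    if e: "e \<ge> 0" and k1: "k1 \<ge> k0"
      and small: "\<And>k. k \<ge> k1 \<Longrightarrow> \<mu> (1 - 1 / real (N k)) * sphere_sup (P k) \<le> e"
      and z: "\<delta> \<le> norm z" "norm z < 1" for e k1 z
  proof -
    define r where "r = norm z"
    have r: "\<delta> \<le> r" "r < 1" "0 < r" using z pars by (auto simp: r_def)
    have \<mu>_pos: "\<mu> r > 0" using \<mu> r by (simp add: normal_weight_pos)
    define y where "y k = real (N k) * (1 - r)" for k
    have y_pos: "y k > 0" for k using r N_pos by (simp add: y_def)
    have y_gap: "y (Suc k) \<ge> c * y k" for k
      using gap[of k] N_pos[of k] r by (simp add: y_def le_divide_eq mult_right_mono)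
    \<comment> \<open>Terms below \<open>k1\<close> use only \<open>r ^ N k \<le> 1\<close>. The
      nonnegative lacunary summand is kept for every \<open>k\<close>, so that the lacunary bound
      applies to the whole sum.\<close>
    have term_le: "\<mu> r * cmod (P k z) \<le> (if k < k1 then \<mu> r * sphere_sup (P k) else 0)
        + e * (y k powr \<alpha> * exp (- y k) + y k powr \<beta> * exp (- y k))" for k
    proof (cases "k < k1")
      case True
      have "cmod (P k z) \<le> sphere_sup (P k) * r ^ N k"
        unfolding r_def by (intro homogeneous_polynomial_norm_le hom N_pos)
      also have "\<dots> \<le> sphere_sup (P k)"
        using r M by (intro mult_left_le power_le_one) auto
      finally have "\<mu> r * cmod (P k z) \<le> \<mu> r * sphere_sup (P k)"
        using \<mu>_pos by (intro mult_left_mono) auto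
      moreover have "0 \<le> e * (y k powr \<alpha> * exp (- y k) + y k powr \<beta> * exp (- y k))"
        using e by (intro mult_nonneg_nonneg add_nonneg_nonneg) auto
      ultimately show ?thesis using True by simp
    next
      case False
      define s where "s = 1 - 1 / real (N k)"
      have "real k0 \<le> real (N k)"
        using False k1 hadamard_gap_degree_gt[OF f, of k] by simp
      then have "1 / (1 - \<delta>) < real (N k)" using k0 by linarith
      then have s: "\<delta> \<le> s" "s < 1"
        using pars N_pos[of k] by (auto simp: s_def field_simps)
      then have \<mu>s: "\<mu> s > 0" using pars \<mu> by (intro normal_weight_pos) auto
      have ys: "(1 - r) / (1 - s) = y k" by (simp add: s_def y_def)
      have "\<mu> r * cmod (P k z) \<le> \<mu> r * (sphere_sup (P k) * r ^ N k)"
        unfolding r_def using \<mu>_pos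
        by (intro mult_left_mono homogeneous_polynomial_norm_le hom N_pos) (simp add: r_def)
      also have "\<dots> \<le> \<mu> r * (e / \<mu> s * exp (- y k))"
      proof (intro mult_left_mono mult_mono)
        show "sphere_sup (P k) \<le> e / \<mu> s"
          using small[of k] False \<mu>s by (simp add: s_def le_divide_eq mult.commute)
        show "r ^ N k \<le> exp (- y k)"
          using r by (simp add: y_def power_le_exp)
      qed (use \<mu>_pos \<mu>s e r in auto)
      also have "\<dots> = e * (\<mu> r / \<mu> s * exp (- y k))" by simp
      also have "\<dots> \<le> e * ((y k powr \<alpha> + y k powr \<beta>) * exp (- y k))"
        using ratio[of r s] r s ys e by (intro mult_left_mono mult_right_mono) auto
      finally show ?thesis using False by (simp add: distrib_right)
    qed
    \<comment> \<open>A bound uniform in \<open>n\<close> survives the passage from the partial sums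
      to \<open>f z\<close>.\<close>
    have partial: "cmod (\<Sum>k<n. P k z) \<le> (\<mu> r * (\<Sum>k<k1. sphere_sup (P k)) + e * K) / \<mu> r" for n
    proof -
      have "\<mu> r * cmod (\<Sum>k<n. P k z) \<le> (\<Sum>k<n. \<mu> r * cmod (P k z))"
        using \<mu>_pos norm_sum[of "\<lambda>k. P k z" "{..<n}"]
        by (simp add: sum_distrib_left[symmetric])
      also have "\<dots> \<le> (\<Sum>k<n. (if k < k1 then \<mu> r * sphere_sup (P k) else 0)
          + e * (y k powr \<alpha> * exp (- y k) + y k powr \<beta> * exp (- y k)))"
        by (intro sum_mono term_le)
      also have "\<dots> = (\<Sum>k<n. if k < k1 then \<mu> r * sphere_sup (P k) else 0)
          + e * ((\<Sum>k<n. y k powr \<alpha> * exp (- y k)) + (\<Sum>k<n. y k powr \<beta> * exp (- y k)))"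
        by (simp add: sum.distrib sum_distrib_left distrib_left)
      also have "\<dots> \<le> \<mu> r * (\<Sum>k<k1. sphere_sup (P k)) + e * K"
      proof (intro add_mono mult_left_mono e)
        \<comment> \<open>Here \<open>n\<close> may lie on either side of \<open>k1\<close>;
          nonnegative terms allow the index set to be enlarged to all \<open>k < k1\<close>.\<close>
        have "(\<Sum>k<n. if k < k1 then \<mu> r * sphere_sup (P k) else 0)
            = (\<Sum>k\<in>{..<n} \<inter> {..<k1}. \<mu> r * sphere_sup (P k))"
          by (simp add: sum.inter_restrict)
        also have "\<dots> \<le> (\<Sum>k<k1. \<mu> r * sphere_sup (P k))"
          using M \<mu>_pos by (intro sum_mono2) auto
        finally show "(\<Sum>k<n. if k < k1 then \<mu> r * sphere_sup (P k) else 0)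
            \<le> \<mu> r * (\<Sum>k<k1. sphere_sup (P k))"
          by (simp add: sum_distrib_left)
        show "(\<Sum>k<n. y k powr \<alpha> * exp (- y k)) + (\<Sum>k<n. y k powr \<beta> * exp (- y k)) \<le> K"
          using K\<alpha>[of y n] K\<beta>[of y n] y_pos y_gap by (simp add: K_def)
      qed
      finally show ?thesis using \<mu>_pos by (simp add: le_divide_eq mult.commute)
    qed
    have "(\<lambda>k. P k z) sums f z"
      using f z by (simp add: hadamard_gap_expansion_def)
    then have "(\<lambda>n. cmod (\<Sum>k<n. P k z)) \<longlonglongrightarrow> cmod (f z)"
      unfolding sums_def by (rule tendsto_norm)
    then have "cmod (f z) \<le> (\<mu> r * (\<Sum>k<k1. sphere_sup (P k)) + e * K) / \<mu> r"
      using partial by (intro LIMSEQ_le_const2) auto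
    then show ?thesis
      using \<mu>_pos by (simp add: r_def[symmetric] le_divide_eq mult.commute)
  qed
  show thesis
  proof (rule that[of K \<delta> k0])
    show "K > 0" by (simp add: K_def)
  qed (use pars main in auto)
qed

section \<open>The two characterisations\<close>

lemma holomorphic_ball_bounded_on_cball:
  fixes f :: "complex ^ 'n \<Rightarrow> complex"
  assumes "f \<in> holomorphic_ball" "\<delta> < 1"
  obtains B where "\<And>z. norm z \<le> \<delta> \<Longrightarrow> cmod (f z) \<le> B"
proof -
  have "continuous_on (cball 0 \<delta>) f"
  proof (intro continuous_at_imp_continuous_on ballI)
    fix z :: "complex ^ 'n" assume "z \<in> cball 0 \<delta>"
    then have "z \<in> ball 0 1" using assms(2) by auto
    then obtain D where "(f has_derivative D) (at z)"
      using assms(1) unfolding holomorphic_ball_def by blast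
    then show "isCont f z" by (rule has_derivative_continuous)
  qed
  then have "bounded (f ` cball 0 \<delta>)"
    by (intro compact_imp_bounded compact_continuous_image) auto
  then show thesis using that unfolding bounded_iff by (metis imageI mem_cball_0)
qed

text \<open>Trades finiteness of an extended real supremum for a real bound. A point of
  \<open>A\<close> excludes the value minus infinity, so a finite supremum is itself such a
  bound.\<close>

lemma SUP_ereal_less_PInf_iff:
  assumes "A \<noteq> {}"
  shows "(SUP x\<in>A. ereal (g x)) < \<infinity> \<longleftrightarrow> (\<exists>B. \<forall>x\<in>A. g x \<le> B)"
proof
  assume *: "(SUP x\<in>A. ereal (g x)) < \<infinity>"
  obtain x where "x \<in> A" using assms by blast
  then have "ereal (g x) \<le> (SUP x\<in>A. ereal (g x))" by (rule SUP_upper)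
  with * obtain B where "(SUP x\<in>A. ereal (g x)) = ereal B"
    by (cases "SUP x\<in>A. ereal (g x)") auto
  then have "\<forall>x\<in>A. ereal (g x) \<le> ereal B" by (metis SUP_upper)
  then show "\<exists>B. \<forall>x\<in>A. g x \<le> B" by auto
next
  assume "\<exists>B. \<forall>x\<in>A. g x \<le> B"
  then obtain B where "\<forall>x\<in>A. g x \<le> B" by blast
  then have "(SUP x\<in>A. ereal (g x)) \<le> ereal B" by (intro SUP_least) auto
  then show "(SUP x\<in>A. ereal (g x)) < \<infinity>" by (rule le_less_trans) simp
qed

lemma hadamard_gap_in_weighted_space_iff:
  fixes f :: "complex ^ 'n \<Rightarrow> complex"
  assumes \<mu>: "normal_weight \<mu>" and f: "hadamard_gap_expansion f N P"
  shows "f \<in> weighted_space \<mu> \<longleftrightarrow>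
    (\<exists>C. \<forall>k\<ge>1. \<mu> (1 - 1 / real (N k)) * sphere_sup (P k) \<le> C)"
proof -
  have hol: "f \<in> holomorphic_ball"
    using f by (simp add: hadamard_gap_expansion_def)
  then have space: "f \<in> weighted_space \<mu> \<longleftrightarrow>
      (\<exists>B. \<forall>z\<in>ball 0 1. \<mu> (norm z) * cmod (f z) \<le> B)"
    unfolding weighted_space_def weighted_norm_def by (simp add: SUP_ereal_less_PInf_iff del: less_ereal.simps ereal_infty_less)
  show ?thesis unfolding space
  proof
    assume "\<exists>B. \<forall>z\<in>ball 0 1. \<mu> (norm z) * cmod (f z) \<le> B"
    then obtain B where B: "\<And>z. norm z < 1 \<Longrightarrow> \<mu> (norm z) * cmod (f z) \<le> B"
      by (metis mem_ball_0)
    have "\<mu> (1 - 1 / real (N k)) * sphere_sup (P k) \<le> B * exp 2" if "k \<ge> 1" for k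
      using \<mu> f that
    proof (rule hadamard_gap_weighted_coefficient_bound)
      fix z :: "complex ^ 'n" assume "norm z = 1 - 1 / real (N k)"
      moreover have "N k > 0" using f by (simp add: hadamard_gap_expansion_def)
      ultimately show "\<mu> (norm z) * cmod (f z) \<le> B" by (intro B) simp
    qed
    then show "\<exists>C. \<forall>k\<ge>1. \<mu> (1 - 1 / real (N k)) * sphere_sup (P k) \<le> C" by blast
  next
    assume "\<exists>C. \<forall>k\<ge>1. \<mu> (1 - 1 / real (N k)) * sphere_sup (P k) \<le> C"
    then obtain C where C: "\<And>k. k \<ge> 1 \<Longrightarrow> \<mu> (1 - 1 / real (N k)) * sphere_sup (P k) \<le> C"
      by blast
    obtain K \<delta> k0 where K: "K > 0" "0 < \<delta>" "\<delta> < 1"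
      and growth: "\<And>e k1 z. e \<ge> 0 \<Longrightarrow> k1 \<ge> k0 \<Longrightarrow>
        (\<And>k. k \<ge> k1 \<Longrightarrow> \<mu> (1 - 1 / real (N k)) * sphere_sup (P k) \<le> e) \<Longrightarrow>
        \<delta> \<le> norm z \<Longrightarrow> norm z < 1 \<Longrightarrow>
        \<mu> (norm z) * cmod (f z) \<le> \<mu> (norm z) * (\<Sum>k<k1. sphere_sup (P k)) + e * K"
      using hadamard_gap_weighted_growth[OF \<mu> f] by metis
    obtain B where B: "\<And>r. 0 \<le> r \<Longrightarrow> r < 1 \<Longrightarrow> \<mu> r \<le> B"
      using normal_weight_bounded[OF \<mu>] by metis
    obtain F where F: "\<And>z. norm z \<le> \<delta> \<Longrightarrow> cmod (f z) \<le> F"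
      using holomorphic_ball_bounded_on_cball[OF hol \<open>\<delta> < 1\<close>] by metis
    have B_nonneg: "B \<ge> 0"
      using B[of 0] normal_weight_pos[OF \<mu>, of 0] by simp
    \<comment> \<open>The hypothesis starts at \<open>k = 1\<close>, so the term with index 0 must
      fall into the finite head.\<close>
    define k1 where "k1 = max 1 k0"
    define S where "S = (\<Sum>k<k1. sphere_sup (P k))"
    have "S \<ge> 0"
      unfolding S_def using f
      by (intro sum_nonneg) (auto simp: hadamard_gap_expansion_def intro: sphere_sup_nonneg)
    \<comment> \<open>Inside radius \<open>\<delta>\<close> both factors are bounded by compactness;
      outside, the growth estimate applies with the nonnegative value \<open>\<bar>C\<bar>\<close>
      for \<open>e\<close>.\<close>
    have "\<mu> (norm z) * cmod (f z) \<le> max (B * F) (B * S + \<bar>C\<bar> * K)" if z: "z \<in> ball 0 1" for z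
    proof (cases "norm z \<le> \<delta>")
      case True
      then have "\<mu> (norm z) * cmod (f z) \<le> B * F"
        using z B_nonneg by (intro mult_mono B F) auto
      then show ?thesis by simp
    next
      case False
      have "\<mu> (norm z) * cmod (f z) \<le> \<mu> (norm z) * S + \<bar>C\<bar> * K"
        unfolding S_def
      proof (rule growth)
        fix k assume "k1 \<le> k"
        then show "\<mu> (1 - 1 / real (N k)) * sphere_sup (P k) \<le> \<bar>C\<bar>"
          using C[of k] by (simp add: k1_def)
      qed (use z False in \<open>auto simp: k1_def\<close>)
      also have "\<dots> \<le> B * S + \<bar>C\<bar> * K"
        using z B[of "norm z"] \<open>S \<ge> 0\<close> by (intro add_mono mult_right_mono order_refl) auto
      finally show ?thesis by simp
    qed
    then show "\<exists>B. \<forall>z\<in>ball 0 1. \<mu> (norm z) * cmod (f z) \<le> B" by blast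
  qed
qed

lemma hadamard_gap_in_little_weighted_space_iff:
  fixes f :: "complex ^ 'n \<Rightarrow> complex"
  assumes \<mu>: "normal_weight \<mu>" and f: "hadamard_gap_expansion f N P"
  shows "f \<in> little_weighted_space \<mu> \<longleftrightarrow>
    (\<lambda>k. \<mu> (1 - 1 / real (N k)) * sphere_sup (P k)) \<longlonglongrightarrow> 0"
proof -
  have N_gt: "real k < real (N k)" for k
    using hadamard_gap_degree_gt[OF f, of k] by simp
  have N_pos: "N k > 0" for k
    using f by (simp add: hadamard_gap_expansion_def)
  have \<mu>M: "0 \<le> \<mu> (1 - 1 / real (N k)) * sphere_sup (P k)" for k
    using f N_pos[of k] normal_weight_pos[OF \<mu>, of "1 - 1 / real (N k)"]
    by (intro mult_nonneg_nonneg)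
       (auto simp: hadamard_gap_expansion_def Suc_leI less_imp_le intro: sphere_sup_nonneg)
  show ?thesis
  proof
    assume "f \<in> little_weighted_space \<mu>"
    then have lim: "((\<lambda>z. \<mu> (norm z) * cmod (f z)) \<longlongrightarrow> 0) (filtercomap norm (at_left 1))"
      by (simp add: little_weighted_space_def)
    show "(\<lambda>k. \<mu> (1 - 1 / real (N k)) * sphere_sup (P k)) \<longlonglongrightarrow> 0"
    proof (rule order_tendstoI)
      fix a :: real assume "a < 0"
      then show "\<forall>\<^sub>F k in sequentially. a < \<mu> (1 - 1 / real (N k)) * sphere_sup (P k)"
        using \<mu>M by (intro always_eventually allI) (rule less_le_trans)
    next
      fix e :: real assume e: "0 < e"
      \<comment> \<open>Dividing by \<open>exp 2\<close> offsets the loss in Cauchy's inequality;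
        the extra factor 2 restores strictness.\<close>
      define e' where "e' = e / exp 2 / 2"
      have "e' > 0" using e by (simp add: e'_def)
      then have "\<forall>\<^sub>F z in filtercomap norm (at_left 1). \<mu> (norm z) * cmod (f z) < e'"
        using lim by (intro order_tendstoD)
      then obtain b where b: "b < 1"
        "\<And>z. b < norm z \<Longrightarrow> norm z < 1 \<Longrightarrow> \<mu> (norm z) * cmod (f z) < e'"
        unfolding eventually_filtercomap eventually_at_left_field by metis
      obtain k0 :: nat where k0: "k0 > 1 / (1 - b)"
        using reals_Archimedean2 by blast
      have "\<mu> (1 - 1 / real (N k)) * sphere_sup (P k) < e" if k: "k \<ge> max 1 k0" for k
      proof -
        have "1 / (1 - b) < real (N k)" using k k0 N_gt[of k] by linarith
        then have "b < 1 - 1 / real (N k)"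
          using b(1) N_pos[of k] by (simp add: field_simps)
        then have "\<mu> (norm z) * cmod (f z) \<le> e'" if "norm z = 1 - 1 / real (N k)" for z
          using b(2)[of z] that N_pos[of k] by simp
        then have "\<mu> (1 - 1 / real (N k)) * sphere_sup (P k) \<le> e' * exp 2"
          using k by (intro hadamard_gap_weighted_coefficient_bound[OF \<mu> f]) auto
        then show ?thesis using e by (simp add: e'_def)
      qed
      then show "\<forall>\<^sub>F k in sequentially. \<mu> (1 - 1 / real (N k)) * sphere_sup (P k) < e"
        unfolding eventually_sequentially by blast
    qed
  next
    assume lim: "(\<lambda>k. \<mu> (1 - 1 / real (N k)) * sphere_sup (P k)) \<longlonglongrightarrow> 0"
    \<comment> \<open>A convergent sequence is bounded, so membership in the big space follows from
      its characterisation.\<close>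
    have "Bseq (\<lambda>k. \<mu> (1 - 1 / real (N k)) * sphere_sup (P k))"
      using lim by (intro convergent_imp_Bseq convergentI)
    then have "f \<in> weighted_space \<mu>"
      unfolding hadamard_gap_in_weighted_space_iff[OF \<mu> f] Bseq_def real_norm_def
      by (blast intro: abs_le_D1)
    moreover have "((\<lambda>z. \<mu> (norm z) * cmod (f z)) \<longlongrightarrow> 0) (filtercomap norm (at_left 1))"
    proof -
      obtain K \<delta> k0 where K: "K > 0" "0 < \<delta>" "\<delta> < 1"
        and growth: "\<And>e k1 z. e \<ge> 0 \<Longrightarrow> k1 \<ge> k0 \<Longrightarrow>
          (\<And>k. k \<ge> k1 \<Longrightarrow> \<mu> (1 - 1 / real (N k)) * sphere_sup (P k) \<le> e) \<Longrightarrow>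
          \<delta> \<le> norm z \<Longrightarrow> norm z < 1 \<Longrightarrow>
          \<mu> (norm z) * cmod (f z) \<le> \<mu> (norm z) * (\<Sum>k<k1. sphere_sup (P k)) + e * K"
        using hadamard_gap_weighted_growth[OF \<mu> f] by metis
      have near: "\<forall>\<^sub>F r in at_left (1::real). r \<in> {\<delta><..<1}"
        using K by (intro eventually_at_left_real)
      show ?thesis
      proof (rule tendstoI)
        fix e :: real assume e: "0 < e"
        \<comment> \<open>The tail receives \<open>e / 2\<close> after multiplication by
          \<open>K\<close>, leaving \<open>e / 2\<close> for the head.\<close>
        define e' where "e' = e / 2 / K"
        have "e' > 0" using e K by (simp add: e'_def)
        then have "\<forall>\<^sub>F k in sequentially. \<mu> (1 - 1 / real (N k)) * sphere_sup (P k) < e'"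
          using lim by (intro order_tendstoD)
        then obtain k' where k': "\<And>k. k \<ge> k' \<Longrightarrow> \<mu> (1 - 1 / real (N k)) * sphere_sup (P k) < e'"
          by (auto simp: eventually_sequentially)
        \<comment> \<open>\<open>S\<close> is fixed before \<open>r\<close> tends to 1, so
          \<open>\<mu> r * S\<close> tends to 0.\<close>
        define S where "S = (\<Sum>k<max k0 k'. sphere_sup (P k))"
        have "((\<lambda>r. \<mu> r * S) \<longlongrightarrow> 0) (at_left 1)"
          using normal_weight_tendsto_0[OF \<mu>] by (rule tendsto_mult_left_zero)
        then have "\<forall>\<^sub>F r in at_left 1. \<mu> r * S < e / 2"
          using e by (intro order_tendstoD) auto
        with near have "\<forall>\<^sub>F r in at_left 1. r \<in> {\<delta><..<1} \<and> \<mu> r * S < e / 2"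
          by (rule eventually_conj)
        then have "\<forall>\<^sub>F z in filtercomap norm (at_left 1).
            norm (z :: complex ^ 'n) \<in> {\<delta><..<1} \<and> \<mu> (norm z) * S < e / 2"
          by (rule eventually_filtercomapI)
        then show "\<forall>\<^sub>F z in filtercomap norm (at_left 1). dist (\<mu> (norm z) * cmod (f z)) 0 < e"
        proof eventually_elim
          case (elim z)
          have "\<mu> (norm z) * cmod (f z) \<le> \<mu> (norm z) * S + e' * K"
            unfolding S_def using elim k' \<open>e' > 0\<close> by (intro growth) (auto intro: less_imp_le)
          also have "\<dots> < e" using elim K by (simp add: e'_def)
          finally show ?case
            using elim normal_weight_pos[OF \<mu>, of "norm z"] by (simp add: abs_mult)
        qed
      qed
    qed
    ultimately show "f \<in> little_weighted_space \<mu>"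
      by (simp add: little_weighted_space_def)
  qed
qed

theorem theorem2p2:
  fixes \<mu> :: "real \<Rightarrow> real"
    and f :: "complex ^ 'n \<Rightarrow> complex"
    and N :: "nat \<Rightarrow> nat"
    and P :: "nat \<Rightarrow> complex ^ 'n \<Rightarrow> complex"
  assumes "normal_weight \<mu>"
    and "hadamard_gap_expansion f N P"
  shows "(f \<in> weighted_space \<mu> \<longleftrightarrow>
            (SUP k\<in>{1..}. ereal (\<mu> (1 - 1 / real (N k)) * sphere_sup (P k))) < \<infinity>) \<and>
         (f \<in> little_weighted_space \<mu> \<longleftrightarrow>
            (\<lambda>k. \<mu> (1 - 1 / real (N k)) * sphere_sup (P k)) \<longlonglongrightarrow> 0)"
  unfolding hadamard_gap_in_weighted_space_iff[OF assms]
    hadamard_gap_in_little_weighted_space_iff[OF assms]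
  by (subst SUP_ereal_less_PInf_iff) auto

end
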